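(* Let $T$ be an infinite $(q+1)$-homogeneous tree rooted at $o$ and let $0<p<\infty$. Then, for $v\in T\setminus\{o\}$, we have the following: (a) If $f\in\mathbb{T}_p$, then $|f(v)|\le\{(q+1)q^{|v|-1}\}^{1/p}\,\|f\|_p$. (b) If $f\in\mathbb{T}_{p,0}$, then $\displaystyle\lim_{|v|\to\infty}\frac{f(v)}{\{(q+1)q^{|v|-1}\}^{1/p}}=0$. The results are sharp.
   Context: A tree is a connected, locally finite graph (every vertex has finitely many neighbours) without cycles. It is $(q+1)$-homogeneous if every vertex has exactly $q+1$ neighbours; here $q\ge 1$ is an integer. It is rooted at $o$ if the vertex $o$ (the root) is singled out. For a vertex $v$, $|v|$ is the number of edges in the unique path from $o$ to $v$; for $n\ge1$ there are $(q+1)q^{n-1}$ vertices with $|v|=n$. Functions on $T$ are functions on its vertices, and $v\in T$ means that $v$ is a vertex of $T$. Let $\mathbb{N}=\{1,2,\dots\}$ and $\mathbb{N}_0=\mathbb{N}\cup\{0\}$. For $f\colon T\to\mathbb{C}$, $0<p<\infty$ and $n\in\mathbb{N}$, put $M_p(n,f)=\left(\frac{1}{(q+1)q^{n-1}}\sum_{|v|=n}|f(v)|^p\right)^{1/p}$, and put $M_p(0,f)=|f(o)|$. Let $\|f\|_p=\sup_{n\in\mathbb{N}_0}M_p(n,f)$, $\mathbb{T}_p=\{f\colon T\to\mathbb{C}:\|f\|_p<\infty\}$ and $\mathbb{T}_{p,0}=\{f\in\mathbb{T}_p:\lim_{n\to\infty}M_p(n,f)=0\}$. In (b), $\lim_{|v|\to\infty}g(v)=0$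 means: for every $\epsilon>0$ there is $N$ such that $|g(v)|<\epsilon$ for all vertices $v$ with $|v|\ge N$. *)

theory Defs
  imports Complex_Main "HOL-Library.Extended_Real" "Graph_Theory.Digraph_Component"
begin

text \<open>
  A simple undirected graph, possibly infinite, is a bidirected pair digraph: its arc relation
  is symmetric and irreflexive. The constants \<open>forest\<close> and \<open>tree\<close> of the graph library are not
  usable here: they forbid directed cycles, and a symmetric digraph has such a cycle \<open>u, w, u\<close>
  for every edge. A cycle of an undirected simple graph has at least three edges.
  The graph-theoretic \<open>connected\<close> is qualified because of the topological constant of that name.
\<close>

definition acyclic_graph :: "'a pair_pre_digraph \<Rightarrow> bool" where
  "acyclic_graph T \<longleftrightarrow> \<not> (\<exists>c. pre_digraph.cycle (with_proj T) c \<and> 3 \<le> length c)"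

definition locally_finite_graph :: "'a pair_pre_digraph \<Rightarrow> bool" where
  "locally_finite_graph T \<longleftrightarrow> (\<forall>v \<in> pverts T. finite {w. (v, w) \<in> parcs T})"

definition tree_graph :: "'a pair_pre_digraph \<Rightarrow> bool" where
  "tree_graph T \<longleftrightarrow>
     pair_bidirected_digraph T \<and> Digraph_Component.connected (with_proj T) \<and>
     locally_finite_graph T \<and> acyclic_graph T"

definition homogeneous_tree :: "nat \<Rightarrow> 'a pair_pre_digraph \<Rightarrow> bool" where
  "homogeneous_tree q T \<longleftrightarrow>
     tree_graph T \<and> (\<forall>v \<in> pverts T. card {w. (v, w) \<in> parcs T} = q + 1)"

text \<open>The number of edges of the unique path from the root \<open>r\<close> to \<open>v\<close>, written \<open>|v|\<close>.\<close>

definition level :: "'a pair_pre_digraph \<Rightarrow> 'a \<Rightarrow> 'a \<Rightarrow> nat" where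
  "level T r v = (THE n. \<exists>c. pre_digraph.apath (with_proj T) r c v \<and> length c = n)"

text \<open>
  The number \<open>(q+1)q\<^sup>n\<^sup>-\<^sup>1\<close> of vertices with \<open>|v| = n\<close>, for \<open>n \<ge> 1\<close>; the value at \<open>n = 0\<close>,
  where the exponent is truncated, has no meaning.
\<close>

definition sphere_size :: "nat \<Rightarrow> nat \<Rightarrow> real" where
  "sphere_size q n = (real q + 1) * real q ^ (n - 1)"

text \<open>
  Functions on \<open>T\<close> are functions on the whole vertex type; values outside \<open>pverts T\<close>
  are never used.
\<close>

definition Mp :: "nat \<Rightarrow> 'a pair_pre_digraph \<Rightarrow> 'a \<Rightarrow> real \<Rightarrow> nat \<Rightarrow> ('a \<Rightarrow> complex) \<Rightarrow> real" where
  "Mp q T r p n f =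
     (if n = 0 then cmod (f r)
      else (1 / sphere_size q n *
             (\<Sum>v \<in> {v \<in> pverts T. level T r v = n}. cmod (f v) powr p)) powr (1 / p))"

definition Tp_norm :: "nat \<Rightarrow> 'a pair_pre_digraph \<Rightarrow> 'a \<Rightarrow> real \<Rightarrow> ('a \<Rightarrow> complex) \<Rightarrow> ereal" where
  "Tp_norm q T r p f = (SUP n. ereal (Mp q T r p n f))"

definition Tp :: "nat \<Rightarrow> 'a pair_pre_digraph \<Rightarrow> 'a \<Rightarrow> real \<Rightarrow> ('a \<Rightarrow> complex) set" where
  "Tp q T r p = {f. Tp_norm q T r p f < \<infinity>}"

definition Tp0 :: "nat \<Rightarrow> 'a pair_pre_digraph \<Rightarrow> 'a \<Rightarrow> real \<Rightarrow> ('a \<Rightarrow> complex) set" where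
  "Tp0 q T r p = {f \<in> Tp q T r p. (\<lambda>n. Mp q T r p n f) \<longlonglongrightarrow> 0}"

definition vanishes_at_infinity :: "'a pair_pre_digraph \<Rightarrow> 'a \<Rightarrow> ('a \<Rightarrow> complex) \<Rightarrow> bool" where
  "vanishes_at_infinity T r g \<longleftrightarrow>
     (\<forall>\<epsilon>>0. \<exists>N. \<forall>v \<in> pverts T. N \<le> level T r v \<longrightarrow> cmod (g v) < \<epsilon>)"

text \<open>
  Sharpness of the growth estimate: at every vertex other than the root, equality is attained
  by some function with nonzero norm.
\<close>

definition growth_estimate_sharp :: "nat \<Rightarrow> 'a pair_pre_digraph \<Rightarrow> 'a \<Rightarrow> real \<Rightarrow> bool" where
  "growth_estimate_sharp q T r p \<longleftrightarrow>
     (\<forall>v \<in> pverts T - {r}. \<exists>f \<in> Tp q T r p.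
        Tp_norm q T r p f > 0 \<and>
        ereal (cmod (f v)) = ereal (sphere_size q (level T r v) powr (1 / p)) * Tp_norm q T r p f)"

text \<open>
  Sharpness of the little-o estimate. First, the rate cannot be improved: along any choice of
  one vertex per level, any prescribed null sequence \<open>\<epsilon>\<close> is attained as the normalised size of
  a member of the small space. Second, the estimate fails on the large space.
\<close>

definition little_o_estimate_sharp :: "nat \<Rightarrow> 'a pair_pre_digraph \<Rightarrow> 'a \<Rightarrow> real \<Rightarrow> bool" where
  "little_o_estimate_sharp q T r p \<longleftrightarrow>
     (\<forall>(w :: nat \<Rightarrow> 'a) (\<epsilon> :: nat \<Rightarrow> real).
        (\<forall>n. w n \<in> pverts T \<and> level T r (w n) = n) \<and> (\<forall>n. 0 \<le> \<epsilon> n) \<and> \<epsilon> \<longlonglongrightarrow> 0 \<longrightarrow>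
        (\<exists>f \<in> Tp0 q T r p. \<forall>n\<ge>1. cmod (f (w n)) / sphere_size q n powr (1 / p) = \<epsilon> n)) \<and>
     (\<exists>f \<in> Tp q T r p.
        \<not> vanishes_at_infinity T r
            (\<lambda>v. f v / complex_of_real (sphere_size q (level T r v) powr (1 / p))))"

end

theory Submission
  imports Defs
begin

text \<open>
  A vertex \<open>v\<close> of level \<open>n \<ge> 1\<close> contributes \<open>|f v|\<^sup>p / ((q+1)q\<^sup>n\<^sup>-\<^sup>1)\<close> to the \<open>p\<close>-th power of \<open>M\<^sub>p(n,f)\<close>,
  so \<open>|f v|\<close> is at most \<open>M\<^sub>p(n,f)\<close> times \<open>((q+1)q\<^sup>n\<^sup>-\<^sup>1)\<^sup>1\<^sup>/\<^sup>p\<close>; both estimates follow. Sharpness is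
  witnessed by functions supported on at most one vertex per level, for which this bound is an equality.
  The sums make sense because paths of a tree are unique (two distinct paths of minimal total length
  with the same ends would form a cycle) and, by local finiteness, the spheres are finite.
\<close>

section \<open>Cycles from pairs of distinct paths\<close>

text \<open>Induction on the total length. A common inner vertex cuts both paths into pieces, and
  one pair of pieces still differs; without such a vertex, \<open>p\<close> followed by the reverse
  of \<open>q\<close> is the cycle.\<close>

lemma (in pair_sym_digraph) cycle_of_two_apaths:
  assumes "apath u p v" "apath u q v" "p \<noteq> q"
  shows "\<exists>c. cycle c \<and> 3 \<le> length c"
  using assms
proof (induction "length p + length q" arbitrary: u v p q rule: less_induct)
  case less
  have p: "awalk u p v" "distinct (awalk_verts u p)" and q: "awalk u q v" "distinct (awalk_verts u q)"
    using less.prems by (auto simp: apath_def)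
  show ?case
  proof (cases "\<exists>x. x \<in> set (awalk_verts u p) \<and> x \<in> set (awalk_verts u q) \<and> x \<noteq> u \<and> x \<noteq> v")
    case True
    then obtain x where x: "x \<in> set (awalk_verts u p)" "x \<in> set (awalk_verts u q)" "x \<noteq> u" "x \<noteq> v"
      by blast
    obtain p1 p2 where p12: "p = p1 @ p2" "awalk u p1 x" "awalk x p2 v"
      using awalk_decomp[OF p(1) x(1)] by blast
    obtain q1 q2 where q12: "q = q1 @ q2" "awalk u q1 x" "awalk x q2 v"
      using awalk_decomp[OF q(1) x(2)] by blast
    have last: "awlast u p1 = x" "awlast u q1 = x"
      using p12 q12 by auto
    have paths: "apath u p1 x" "apath x p2 v" "apath u q1 x" "apath x q2 v"
      using less.prems(1,2) unfolding p12(1) q12(1) by (auto simp: apath_append_iff last[simplified])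
    have "p1 \<noteq> []" "p2 \<noteq> []" "q1 \<noteq> []" "q2 \<noteq> []"
      using p12 q12 x(3,4) by (auto simp: awalk_Nil_iff)
    then have "length p1 + length q1 < length p + length q" "length p2 + length q2 < length p + length q"
      by (auto simp: p12(1) q12(1))
    moreover have "p1 \<noteq> q1 \<or> p2 \<noteq> q2"
      using less.prems(3) p12(1) q12(1) by auto
    ultimately show ?thesis
      using less.hyps paths by blast
  next
    case False
    let ?c = "p @ rev_path q"
    have walk: "awalk u ?c u"
      using p(1) q(1) by (intro awalk_appendI) auto
    have last: "awlast u p = v"
      using p(1) by auto
    have "awalk_verts u ?c = awalk_verts u p @ tl (rev (awalk_verts u q))"
      using awalk_verts_append[OF walk] awalk_verts_rev_path[OF q(1)] last by simp
    then have verts: "tl (awalk_verts u ?c) = tl (awalk_verts u p) @ tl (rev (awalk_verts u q))"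
      by simp
    obtain ps where ps: "awalk_verts u p = u # ps"
      using p(1) by (cases "awalk_verts u p") auto
    have lastq: "awlast u q = v"
      using q(1) by auto
    obtain qs where qs: "rev (awalk_verts u q) = v # qs"
      using lastq by (cases "awalk_verts u q" rule: rev_cases) auto
    have setqs: "insert v (set qs) = set (awalk_verts u q)"
      using arg_cong[OF qs, of set] by simp
    have "distinct (v # qs)"
      using q(2) unfolding qs[symmetric] by simp
    \<comment> \<open>The paths meet only in their ends, and \<open>ps\<close> lacks
      \<open>u\<close> while \<open>qs\<close> lacks \<open>v\<close>, so the two halves are
      disjoint.\<close>
    then have dist: "distinct (tl (awalk_verts u ?c))"
      using p(2) False setqs unfolding verts ps qs by auto
    \<comment> \<open>Both paths are nonempty, since otherwise \<open>u = v\<close> and both would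
      be empty. A shorter closed walk would thus make each a single arc from \<open>u\<close> to
      \<open>v\<close>, hence equal.\<close>
    have "\<not> length ?c < 3"
    proof
      have loop: "s = []" if "apath u s u" for s
        using apath_nonempty_ends[OF that] by blast
      have ne: "p \<noteq> [] \<and> q \<noteq> []"
        using less.prems loop[of p] loop[of q] by (metis apath_Nil_iff)
      have len: "length (rev_path s) = length s" for s :: "('a \<times> 'a) list"
        by (induction s) auto
      assume "length ?c < 3"
      with ne have "length p = 1" "length q = 1"
        by (auto simp: len Suc_le_eq less_Suc_eq numeral_3_eq_3 neq_Nil_conv)
      then obtain a b where "p = [a]" "q = [b]"
        by (auto simp: length_Suc_conv)
      with p(1) q(1) less.prems(3) show False
        by (auto simp: awalk_simps prod_eq_iff)
    qed
    then have "?c \<noteq> [] \<and> 3 \<le> length ?c" by auto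
    with walk dist show ?thesis
      unfolding cycle_def by blast
  qed
qed

lemma sphere_size_pos: "q \<ge> 1 \<Longrightarrow> 0 < sphere_size q n"
  by (simp add: sphere_size_def)

section \<open>Levels and spheres of a rooted tree\<close>

locale rooted_tree =
  fixes T :: "'a pair_pre_digraph" and r :: 'a
  assumes tree: "tree_graph T" and root: "r \<in> pverts T"
begin

sublocale pair_bidirected_digraph T
  using tree by (simp add: tree_graph_def)

abbreviation sphere :: "nat \<Rightarrow> 'a set" where
  "sphere n \<equiv> {v \<in> pverts T. level T r v = n}"

text \<open>\<open>level\<close> is a definite description, so evaluating it needs uniqueness of the
  path length; acyclicity gives this through \<open>cycle_of_two_apaths\<close>.\<close>

lemma level_eq:
  assumes "apath r c v"
  shows "level T r v = length c"
  unfolding level_def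
proof (rule the_equality)
  show "\<exists>c'. apath r c' v \<and> length c' = length c"
    using assms by blast
  show "n = length c" if "\<exists>c'. apath r c' v \<and> length c' = n" for n
  proof -
    from that obtain c' where c': "apath r c' v" "length c' = n"
      by blast
    have "\<nexists>c. cycle c \<and> 3 \<le> length c"
      using tree by (simp add: tree_graph_def acyclic_graph_def)
    then have "c' = c"
      using cycle_of_two_apaths[OF c'(1) assms] by blast
    with c' show ?thesis by simp
  qed
qed

text \<open>The existence half: in a symmetric digraph connectedness is strong connectedness, so the
  root reaches every vertex.\<close>

lemma level_apath:
  assumes "v \<in> pverts T"
  obtains c where "apath r c v" "length c = level T r v"
proof -
  have "strongly_connected T"
    using tree pair_sym_arcs by (intro symmetric_connected_imp_strongly_connected) (auto simp: tree_graph_def)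
  then have "r \<rightarrow>\<^sup>*\<^bsub>T\<^esub> v"
    using assms root by (auto simp: strongly_connected_def)
  then obtain c where "apath r c v"
    unfolding reachable_apath by blast
  with level_eq that show ?thesis by metis
qed

lemma level_pos:
  assumes "v \<in> pverts T - {r}"
  shows "1 \<le> level T r v"
proof -
  obtain c where "apath r c v" "length c = level T r v"
    using assms level_apath by blast
  with assms show ?thesis
    by (cases c) (auto simp: apath_Nil_iff)
qed

lemma level_root: "level T r r = 0"
  using level_eq[of "[]" r] root by (simp add: apath_Nil_iff)

text \<open>Removing the last arc leaves a walk to one of finitely many vertices, each with finitely
  many neighbours.\<close>

lemma finite_walk_ends: "finite {v. \<exists>c. awalk r c v \<and> length c = n}"
proof (induction n)
  case 0
  have "{v. \<exists>c. awalk r c v \<and> length c = 0} \<subseteq> {r}"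
    by (auto simp: awalk_Nil_iff)
  then show ?case
    by (rule finite_subset) simp
next
  case (Suc n)
  let ?A = "{v. \<exists>c. awalk r c v \<and> length c = n}"
  have "{v. \<exists>c. awalk r c v \<and> length c = Suc n} \<subseteq> (\<Union>u\<in>?A. {w. (u, w) \<in> parcs T})"
  proof safe
    fix v c assume c: "awalk r c v" "length c = Suc n"
    then obtain d e where d: "c = d @ [e]"
      by (cases c rule: rev_cases) auto
    with c have "awalk r d (fst e)" "(fst e, v) \<in> parcs T"
      by (auto simp: awalk_simps)
    with c d show "v \<in> (\<Union>u\<in>?A. {w. (u, w) \<in> parcs T})"
      by auto
  qed
  moreover have "finite (\<Union>u\<in>?A. {w. (u, w) \<in> parcs T})"
    using Suc tree by (auto simp: tree_graph_def locally_finite_graph_def)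
  ultimately show ?case
    by (rule finite_subset)
qed

text \<open>A sum over an infinite set is 0 by default, so \<open>Mp\<close> has its intended
  meaning only because of this.\<close>

lemma finite_sphere: "finite (sphere n)"
proof (rule finite_subset[OF _ finite_walk_ends[of n]])
  show "sphere n \<subseteq> {v. \<exists>c. awalk r c v \<and> length c = n}"
  proof
    fix v assume v: "v \<in> sphere n"
    then obtain c where "apath r c v" "length c = level T r v"
      using level_apath by blast
    with v show "v \<in> {v. \<exists>c. awalk r c v \<and> length c = n}"
      unfolding apath_def by blast
  qed
qed

lemma level_unbounded:
  assumes "infinite (pverts T)"
  shows "\<exists>v\<in>pverts T. N \<le> level T r v"
proof (rule ccontr)
  assume "\<not> ?thesis"
  then have "pverts T \<subseteq> (\<Union>n<N. sphere n)"
    by (auto simp: not_le)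
  moreover have "finite (\<Union>n<N. sphere n)"
    using finite_sphere by blast
  ultimately show False
    using assms finite_subset by blast
qed

text \<open>One term of a nonnegative sum is at most the whole sum; taking \<open>p\<close>-th roots
  gives the pointwise bound behind both estimates.\<close>

lemma cmod_le_Mp:
  assumes "q \<ge> 1" "0 < p" "v \<in> pverts T - {r}"
  shows "cmod (f v) \<le> sphere_size q (level T r v) powr (1 / p) * Mp q T r p (level T r v) f"
proof -
  define n where "n = level T r v"
  define S where "S = sphere_size q n"
  have S: "S > 0"
    using assms by (simp add: S_def sphere_size_pos)
  have "cmod (f v) powr p \<le> (\<Sum>v\<in>sphere n. cmod (f v) powr p)"
    using assms finite_sphere[of n]
    by (intro member_le_sum[where f = "\<lambda>v. cmod (f v) powr p"]) (auto simp: n_def)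
  then have "(cmod (f v) powr p) powr (1 / p) \<le> (\<Sum>v\<in>sphere n. cmod (f v) powr p) powr (1 / p)"
    using assms by (intro powr_mono2) auto
  \<comment> \<open>Writing the sum as \<open>S\<close> times the mean lets the root split off the
    factor \<open>S powr (1 / p)\<close>.\<close>
  moreover have "(\<Sum>v\<in>sphere n. cmod (f v) powr p) = S * (1 / S * (\<Sum>v\<in>sphere n. cmod (f v) powr p))"
    using S by simp
  moreover have "\<dots> powr (1 / p) = S powr (1 / p) * (1 / S * (\<Sum>v\<in>sphere n. cmod (f v) powr p)) powr (1 / p)"
    using S by (intro powr_mult)
  ultimately show ?thesis
    using assms level_pos[OF assms(3)] by (simp add: Mp_def powr_powr flip: n_def S_def)
qed

end

section \<open>The norm, and functions with prescribed spherical means\<close>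

lemma Tp_normI: "ereal (Mp q T r p n f) \<le> Tp_norm q T r p f"
  unfolding Tp_norm_def by (rule SUP_upper) simp

lemma in_TpI:
  assumes "\<And>n. Mp q T r p n f \<le> C"
  shows "f \<in> Tp q T r p"
proof -
  have "Tp_norm q T r p f \<le> ereal C"
    unfolding Tp_norm_def using assms by (intro SUP_least) simp
  then show ?thesis
    by (auto simp: Tp_def intro: le_less_trans)
qed

text \<open>Scaled so that the mean over the sphere of radius \<open>n \<ge> 1\<close> is \<open>a n\<close>, provided \<open>w n\<close> lies on it.\<close>

definition peak ::
    "nat \<Rightarrow> 'a pair_pre_digraph \<Rightarrow> 'a \<Rightarrow> real \<Rightarrow> (nat \<Rightarrow> 'a) \<Rightarrow> (nat \<Rightarrow> real) \<Rightarrow> 'a \<Rightarrow> complex" where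
  "peak q T r p w a v =
     (if v = w (level T r v)
      then complex_of_real (a (level T r v) * sphere_size q (level T r v) powr (1 / p)) else 0)"

context rooted_tree
begin

text \<open>At most \<open>w n\<close> contributes on the sphere, and the scaling in
  \<open>peak\<close> cancels the averaging factor. At radius 0 that scaling would be wrong, which
  \<open>a 0 = 0\<close> avoids.\<close>

lemma Mp_peak:
  assumes "q \<ge> 1" "0 < p" "\<And>n. 0 \<le> a n" "a 0 = 0"
  shows "Mp q T r p n (peak q T r p w a) = (if w n \<in> sphere n then a n else 0)"
proof (cases "n = 0")
  case True
  have "peak q T r p w a r = 0"
    unfolding peak_def level_root using assms(4) by simp
  with True show ?thesis
    using assms(4) by (simp add: Mp_def)
next
  case False
  define S where "S = sphere_size q n"
  have S: "S > 0"
    using assms by (simp add: S_def sphere_size_pos)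
  have "(\<Sum>v\<in>sphere n. cmod (peak q T r p w a v) powr p) =
      (\<Sum>v\<in>sphere n. if v = w n then (a n * S powr (1 / p)) powr p else 0)"
    using assms by (intro sum.cong) (auto simp: peak_def S_def norm_mult)
  also have "\<dots> = (if w n \<in> sphere n then (a n * S powr (1 / p)) powr p else 0)"
    using finite_sphere by (simp add: sum.delta)
  also have "(a n * S powr (1 / p)) powr p = S * a n powr p"
    using assms S by (simp add: powr_mult powr_powr)
  finally have "1 / S * (\<Sum>v\<in>sphere n. cmod (peak q T r p w a v) powr p) =
      (if w n \<in> sphere n then a n powr p else 0)"
    using S by simp
  then show ?thesis
    using False assms by (simp add: Mp_def powr_powr flip: S_def)
qed

lemma cmod_peak:
  assumes "q \<ge> 1" "\<And>n. 0 \<le> a n" "level T r (w n) = n"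
  shows "cmod (peak q T r p w a (w n)) = a n * sphere_size q n powr (1 / p)"
  using assms by (simp add: peak_def norm_mult)

section \<open>The two estimates\<close>

lemma growth_estimate:
  assumes "q \<ge> 1" "0 < p" "v \<in> pverts T - {r}"
  shows "ereal (cmod (f v)) \<le> ereal (sphere_size q (level T r v) powr (1 / p)) * Tp_norm q T r p f"
proof -
  have "ereal (cmod (f v)) \<le>
      ereal (sphere_size q (level T r v) powr (1 / p)) * ereal (Mp q T r p (level T r v) f)"
    using cmod_le_Mp[OF assms] by simp
  also have "\<dots> \<le> ereal (sphere_size q (level T r v) powr (1 / p)) * Tp_norm q T r p f"
    by (intro ereal_mult_left_mono Tp_normI) simp
  finally show ?thesis .
qed

lemma little_o_estimate:
  assumes "q \<ge> 1" "0 < p" "f \<in> Tp0 q T r p"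
  shows "vanishes_at_infinity T r
    (\<lambda>v. f v / complex_of_real (sphere_size q (level T r v) powr (1 / p)))"
  unfolding vanishes_at_infinity_def
proof (intro allI impI)
  fix \<epsilon> :: real assume "\<epsilon> > 0"
  have "(\<lambda>n. Mp q T r p n f) \<longlonglongrightarrow> 0"
    using assms by (simp add: Tp0_def)
  then have "\<forall>\<^sub>F n in sequentially. Mp q T r p n f < \<epsilon>"
    using \<open>\<epsilon> > 0\<close> by (rule order_tendstoD)
  then obtain N where N: "\<And>n. n \<ge> N \<Longrightarrow> Mp q T r p n f < \<epsilon>"
    by (auto simp: eventually_sequentially)
  \<comment> \<open>The threshold \<open>max N 1\<close> excludes the root, where
    \<open>cmod_le_Mp\<close> does not apply.\<close>
  have "cmod (f v / complex_of_real (sphere_size q (level T r v) powr (1 / p))) < \<epsilon>"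
    if v: "v \<in> pverts T" "max N 1 \<le> level T r v" for v
  proof -
    have "v \<in> pverts T - {r}"
      using v level_root by auto
    from cmod_le_Mp[OF assms(1,2) this, of f]
    have "cmod (f v) / sphere_size q (level T r v) powr (1 / p) \<le> Mp q T r p (level T r v) f"
      using sphere_size_pos[OF assms(1), of "level T r v"] by (simp add: pos_divide_le_eq mult.commute)
    also have "\<dots> < \<epsilon>"
      using N v by simp
    finally show ?thesis
      by (simp add: norm_divide)
  qed
  then show "\<exists>N. \<forall>v\<in>pverts T. N \<le> level T r v \<longrightarrow>
      cmod (f v / complex_of_real (sphere_size q (level T r v) powr (1 / p))) < \<epsilon>"
    by blast
qed

section \<open>Sharpness of both estimates\<close>

lemma growth_sharp:
  assumes "q \<ge> 1" "0 < p"
  shows "growth_estimate_sharp q T r p"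
  unfolding growth_estimate_sharp_def
proof
  fix v assume v: "v \<in> pverts T - {r}"
  define m where "m = level T r v"
  \<comment> \<open>The extremal function lives on \<open>v\<close> alone: the constant choice
    \<open>v\<close> hits its sphere only at radius \<open>m\<close>, where the mean is 1.\<close>
  define a :: "nat \<Rightarrow> real" where "a n = of_bool (n = m)" for n
  define f where "f = peak q T r p (\<lambda>_. v) a"
  have "a 0 = 0"
    using level_pos[OF v] by (simp add: a_def m_def)
  then have M: "Mp q T r p n f = of_bool (n = m)" for n
    using v Mp_peak[of q p a] assms by (auto simp: f_def a_def m_def)
  have "Tp_norm q T r p f = 1"
    unfolding Tp_norm_def
  proof (rule antisym)
    show "(SUP n. ereal (Mp q T r p n f)) \<le> 1"
      by (intro SUP_least) (simp add: M)
    show "1 \<le> (SUP n. ereal (Mp q T r p n f))"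
      by (rule SUP_upper2[of m]) (auto simp: M)
  qed
  moreover have "f \<in> Tp q T r p"
    by (rule in_TpI[of _ _ _ _ _ 1]) (simp add: M)
  moreover have "cmod (f v) = sphere_size q m powr (1 / p)"
  proof -
    have "cmod (peak q T r p (\<lambda>_. v) a v) = a m * sphere_size q m powr (1 / p)"
      by (rule cmod_peak[where w = "\<lambda>_. v"]) (use assms in \<open>simp_all add: a_def m_def\<close>)
    then show ?thesis
      by (simp add: f_def a_def)
  qed
  ultimately show "\<exists>f\<in>Tp q T r p. Tp_norm q T r p f > 0 \<and>
      ereal (cmod (f v)) = ereal (sphere_size q (level T r v) powr (1 / p)) * Tp_norm q T r p f"
    unfolding m_def by (intro bexI[of _ f]) simp_all
qed

lemma little_o_sharp:
  assumes "q \<ge> 1" "0 < p" "infinite (pverts T)"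
  shows "little_o_estimate_sharp q T r p"
  unfolding little_o_estimate_sharp_def
proof (intro conjI allI impI)
  fix w :: "nat \<Rightarrow> 'a" and \<epsilon> :: "nat \<Rightarrow> real"
  assume *: "(\<forall>n. w n \<in> pverts T \<and> level T r (w n) = n) \<and> (\<forall>n. 0 \<le> \<epsilon> n) \<and> \<epsilon> \<longlonglongrightarrow> 0"
  \<comment> \<open>Resetting the term at 0 meets the requirement of \<open>Mp_peak\<close> and
    changes neither the limit nor the values for \<open>n \<ge> 1\<close>.\<close>
  define a where "a n = (if n = 0 then 0 else \<epsilon> n)" for n
  define f where "f = peak q T r p w a"
  have M: "Mp q T r p n f = a n" for n
    using * assms Mp_peak[of q p a] by (simp add: f_def a_def)
  have lim: "a \<longlonglongrightarrow> 0"
  proof (rule Lim_transform_eventually)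
    show "\<epsilon> \<longlonglongrightarrow> 0" using * by simp
    show "\<forall>\<^sub>F n in sequentially. \<epsilon> n = a n"
      using eventually_gt_at_top[of 0] by eventually_elim (simp add: a_def)
  qed
  obtain C where C: "\<And>n. norm (a n) \<le> C"
    using convergent_imp_Bseq[OF convergentI[OF lim]] by (auto simp: Bseq_def)
  have "f \<in> Tp q T r p"
    using C by (intro in_TpI[of _ _ _ _ _ C]) (simp add: M abs_le_iff)
  then have "f \<in> Tp0 q T r p"
    using lim by (simp add: Tp0_def M)
  moreover have "cmod (f (w n)) / sphere_size q n powr (1 / p) = \<epsilon> n" if "n \<ge> 1" for n
    using that * assms cmod_peak[of q a w n p] by (simp add: f_def a_def sphere_size_def)
  ultimately show "\<exists>f\<in>Tp0 q T r p. \<forall>n\<ge>1. cmod (f (w n)) / sphere_size q n powr (1 / p) = \<epsilon> n"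
    by blast
next
  \<comment> \<open>One vertex is picked on each nonempty sphere. On an empty one the choice is
    arbitrary and the mean is 0, so all means are at most 1.\<close>
  define w where "w n = (SOME v. v \<in> sphere n)" for n
  define a :: "nat \<Rightarrow> real" where "a n = of_bool (n > 0)" for n
  define f where "f = peak q T r p w a"
  have w: "w n \<in> sphere n" if "v \<in> sphere n" for v n
    using that unfolding w_def by (rule someI)
  have "f \<in> Tp q T r p"
    using assms Mp_peak[of q p a] by (intro in_TpI[of _ _ _ _ _ 1]) (simp add: f_def a_def)
  moreover have "\<not> vanishes_at_infinity T r
      (\<lambda>v. f v / complex_of_real (sphere_size q (level T r v) powr (1 / p)))"
  proof
    assume "vanishes_at_infinity T r
      (\<lambda>v. f v / complex_of_real (sphere_size q (level T r v) powr (1 / p)))"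
    then obtain N where N: "\<And>v. v \<in> pverts T \<Longrightarrow> N \<le> level T r v \<Longrightarrow>
        cmod (f v / complex_of_real (sphere_size q (level T r v) powr (1 / p))) < 1"
      unfolding vanishes_at_infinity_def by (meson zero_less_one)
    \<comment> \<open>This vertex shows that the sphere of its level is nonempty. The level is
      positive, so the normalised value at \<open>w n\<close> is exactly 1.\<close>
    obtain v where v: "v \<in> pverts T" "Suc N \<le> level T r v"
      using level_unbounded[OF assms(3)] by blast
    define n where "n = level T r v"
    have wn: "w n \<in> sphere n"
      using v by (intro w[of v]) (simp add: n_def)
    then have "cmod (f (w n)) = sphere_size q n powr (1 / p)"
      using v assms cmod_peak[of q a w n p] by (simp add: f_def a_def n_def)
    with N[of "w n"] wn v assms show False
      by (simp add: norm_divide n_def sphere_size_def)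
  qed
  ultimately show "\<exists>f\<in>Tp q T r p. \<not> vanishes_at_infinity T r
      (\<lambda>v. f v / complex_of_real (sphere_size q (level T r v) powr (1 / p)))"
    by blast
qed

end

theorem lemma3:
  fixes q :: nat and T :: "'a pair_pre_digraph" and r :: 'a and p :: real
  assumes "q \<ge> 1"
    and "homogeneous_tree q T"
    and "infinite (pverts T)"
    and "r \<in> pverts T"
    and "0 < p"
  shows
    "(\<forall>f \<in> Tp q T r p. \<forall>v \<in> pverts T - {r}.
        ereal (cmod (f v)) \<le> ereal (sphere_size q (level T r v) powr (1 / p)) * Tp_norm q T r p f) \<and>
     (\<forall>f \<in> Tp0 q T r p.
        vanishes_at_infinity T r
          (\<lambda>v. f v / complex_of_real (sphere_size q (level T r v) powr (1 / p)))) \<and>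
     growth_estimate_sharp q T r p \<and>
     little_o_estimate_sharp q T r p"
proof -
  interpret rooted_tree T r
    using assms by unfold_locales (simp_all add: homogeneous_tree_def)
  show ?thesis
    using assms by (intro conjI ballI growth_estimate little_o_estimate growth_sharp little_o_sharp)
qed

end
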